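(* Let $\epsilon$ be a constant with $0<\epsilon<0.003$. There exist graphs $G$ with maximum degree $\Delta$ (for arbitrarily large $\Delta$) and minimum degree $\Delta^{1-\epsilon}$ such that $\chi_{CN}(G) = \Omega(\ln^2 \Delta)$.
   Context: A conflict-free closed neighborhood (CFCN) coloring of $G$ is an assignment of colors to $V(G)$ such that for every vertex $v$ some color appears exactly once in the closed neighborhood $N_G[v]=\{v\}\cup N_G(v)$; $\chi_{CN}(G)$ is the minimum number of colors in such a coloring. *)

theory Defs
  imports Complex_Main "Graph_Theory.Pair_Digraph"
begin

(* A finite simple graph is a pair_graph: finite vertex set, symmetric loop-free arc relation,
   so each undirected edge {u, v} is the pair of arcs (u, v), (v, u). *)

definition nbhd :: "'a pair_pre_digraph \<Rightarrow> 'a \<Rightarrow> 'a set" where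
  "nbhd G v = {w \<in> pverts G. (v, w) \<in> parcs G}"

definition closed_nbhd :: "'a pair_pre_digraph \<Rightarrow> 'a \<Rightarrow> 'a set" where
  "closed_nbhd G v = insert v (nbhd G v)"

(* Max and Min are unspecified when there are no vertices. *)
definition max_degree :: "'a pair_pre_digraph \<Rightarrow> nat" where
  "max_degree G = Max ((\<lambda>v. card (nbhd G v)) ` pverts G)"

definition min_degree :: "'a pair_pre_digraph \<Rightarrow> nat" where
  "min_degree G = Min ((\<lambda>v. card (nbhd G v)) ` pverts G)"

definition cfcn_coloring :: "'a pair_pre_digraph \<Rightarrow> ('a \<Rightarrow> 'c) \<Rightarrow> bool" where
  "cfcn_coloring G f \<longleftrightarrow> (\<forall>v \<in> pverts G. \<exists>c. \<exists>!u. u \<in> closed_nbhd G v \<and> f u = c)"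

(* Colors are natural numbers without loss of generality, since G is finite; an injective
   coloring is always a CFCN coloring, so the minimum exists. *)
definition chi_CN :: "'a pair_pre_digraph \<Rightarrow> nat" where
  "chi_CN G = (LEAST k. \<exists>f :: 'a \<Rightarrow> nat. cfcn_coloring G f \<and> card (f ` pverts G) = k)"

end

theory Submission
  imports Defs "HOL-Probability.Probability" "HOL-Real_Asymp.Real_Asymp"
begin

text \<open>
  Take a random graph whose vertices lie on levels \<open>0, \<dots>, L - 1\<close> of equal size, where \<open>u\<close> and \<open>v\<close> are
  adjacent with probability \<open>w u * w v\<close> and \<open>w\<close> halves from one level to the next. A colour class \<open>C\<close> has
  expected number \<open>x = y / 2 ^ i\<close> of neighbours of a level \<open>i\<close> vertex, and it contributes exactly one
  neighbour with probability \<open>O(x exp (- x))\<close>. Summed over all levels this is \<open>O(1)\<close>, whatever the class.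
  So with \<open>K = O(L\<^sup>2)\<close> classes some level has total \<open>O(K / L) = O(L)\<close>, and each vertex of that level
  sees no colour exactly once with probability at least \<open>2 powr (- L)\<close>.

  A union bound over all colourings is too expensive, because the vertices being tested are themselves
  coloured. It suffices to truncate every colour class to at most \<open>T = 24 * 4 ^ L\<close> vertices: a class
  that large is seen at least twice even through its truncation. There are only \<open>n ^ O(T K)\<close>
  truncated families, while a level has \<open>2 ^ (r L)\<close> vertices which are tested independently.
  The ratio \<open>2 ^ L\<close> of the weights is a small power of \<open>n\<close>, which gives the minimum degree.
\<close>

subsection \<open>Independent events in product distributions\<close>

text \<open>The product distribution on \<open>E\<close> is the image of the pair of independent
  products on \<open>A\<close> and \<open>E - A\<close>. As \<open>Q\<close> reads only the first
  and \<open>R\<close> only the second, their conjunction pulls back to a rectangle.\<close>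

lemma prob_Pi_pmf_conj:
  assumes E: "finite E" and A: "A \<subseteq> E"
    and Q: "\<And>f g. (\<forall>e\<in>A. f e = g e) \<Longrightarrow> Q f = Q g"
    and R: "\<And>f g. (\<forall>e\<in>E - A. f e = g e) \<Longrightarrow> R f = R g"
  shows "measure_pmf.prob (Pi_pmf E d p) {f. Q f \<and> R f} =
    measure_pmf.prob (Pi_pmf E d p) {f. Q f} * measure_pmf.prob (Pi_pmf E d p) {f. R f}"
proof -
  let ?M = "Pi_pmf A d p" and ?N = "Pi_pmf (E - A) d p"
  have Eq: "E = A \<union> (E - A)" using A by blast
  have fA: "finite A" using A E finite_subset by blast
  have un: "Pi_pmf E d p = map_pmf (\<lambda>(f, g) x. if x \<in> A then f x else g x) (pair_pmf ?M ?N)"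
    using Pi_pmf_union[of A "E - A" d p] Eq fA E by simp
  have prod: "measure_pmf.prob (Pi_pmf E d p) {f. Q' f \<and> R' f} =
      measure_pmf.prob ?M {f. Q' f} * measure_pmf.prob ?N {f. R' f}"
    if Q': "\<And>f g. (\<forall>e\<in>A. f e = g e) \<Longrightarrow> Q' f = Q' g"
      and R': "\<And>f g. (\<forall>e\<in>E - A. f e = g e) \<Longrightarrow> R' f = R' g" for Q' R'
  proof -
    have "(\<lambda>(f, g) x. if x \<in> A then f x else g x) -` {f. Q' f \<and> R' f} = {f. Q' f} \<times> {f. R' f}"
    proof -
      have "Q' (\<lambda>x. if x \<in> A then f x else g x) = Q' f" for f g by (rule Q') auto
      moreover have "R' (\<lambda>x. if x \<in> A then f x else g x) = R' g" for f g by (rule R') auto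
      ultimately show ?thesis by auto
    qed
    then have "measure_pmf.prob (Pi_pmf E d p) {f. Q' f \<and> R' f} =
        measure_pmf.prob (pair_pmf ?M ?N) ({f. Q' f} \<times> {f. R' f})"
      unfolding un by simp
    \<comment> \<open>Intersecting with the supports makes both sides countable, as the product rule
      requires.\<close>
    also have "\<dots> = measure_pmf.prob (pair_pmf ?M ?N)
        (({f. Q' f} \<inter> set_pmf ?M) \<times> ({f. R' f} \<inter> set_pmf ?N))"
      by (subst measure_Int_set_pmf[symmetric], rule arg_cong[of _ _ "measure_pmf.prob _"]) auto
    also have "\<dots> = measure_pmf.prob ?M ({f. Q' f} \<inter> set_pmf ?M) * measure_pmf.prob ?N ({f. R' f} \<inter> set_pmf ?N)"
      by (rule measure_pmf_prob_product) (auto intro: countable_Int2)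
    finally show ?thesis by (simp add: measure_Int_set_pmf)
  qed
  show ?thesis
    using prod[of Q R] prod[of Q "\<lambda>_. True"] prod[of "\<lambda>_. True" R] Q R by simp
qed

text \<open>Induction on \<open>B\<close>: the coordinates read by the new event are disjoint from
  those read by the others, so one factor splits off.\<close>

lemma prob_Pi_pmf_Ball:
  assumes E: "finite E" and B: "finite B"
    and A: "\<And>v. v \<in> B \<Longrightarrow> A v \<subseteq> E" and disj: "disjoint_family_on A B"
    and Q: "\<And>v f g. v \<in> B \<Longrightarrow> (\<forall>e\<in>A v. f e = g e) \<Longrightarrow> Q v f = Q v g"
  shows "measure_pmf.prob (Pi_pmf E d p) {f. \<forall>v\<in>B. Q v f} =
    (\<Prod>v\<in>B. measure_pmf.prob (Pi_pmf E d p) {f. Q v f})"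
  using B A disj Q
proof (induction B rule: finite_induct)
  case empty
  then show ?case by simp
next
  case (insert v B)
  have dj: "A u \<subseteq> E - A v" if "u \<in> B" for u
  proof -
    have "A v \<inter> A u = {}"
      using insert.prems(2) insert.hyps that by (intro disjoint_family_onD[of A "insert v B"]) auto
    then show ?thesis using insert.prems(1)[of u] that by auto
  qed
  have "measure_pmf.prob (Pi_pmf E d p) {f. \<forall>v\<in>insert v B. Q v f} =
      measure_pmf.prob (Pi_pmf E d p) {f. Q v f \<and> (\<forall>v\<in>B. Q v f)}"
    by simp
  also have "\<dots> = measure_pmf.prob (Pi_pmf E d p) {f. Q v f} *
      measure_pmf.prob (Pi_pmf E d p) {f. \<forall>v\<in>B. Q v f}"
  proof (rule prob_Pi_pmf_conj[where A = "A v"])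
    show "(\<forall>u\<in>B. Q u f) = (\<forall>u\<in>B. Q u g)" if "\<forall>e\<in>E - A v. f e = g e" for f g
    proof (rule ball_cong[OF refl])
      fix u assume u: "u \<in> B"
      show "Q u f = Q u g"
        by (rule insert.prems(3)) (use u dj[OF u] that in auto)
    qed
  qed (use E insert.prems in auto)
  also have "measure_pmf.prob (Pi_pmf E d p) {f. \<forall>v\<in>B. Q v f} =
      (\<Prod>v\<in>B. measure_pmf.prob (Pi_pmf E d p) {f. Q v f})"
  proof (rule insert.IH)
    show "disjoint_family_on A B"
      using insert.prems(2) by (rule disjoint_family_on_mono[rotated]) auto
    show "Q u f = Q u g" if "u \<in> B" "\<forall>e\<in>A u. f e = g e" for u f g
      using that by (intro insert.prems(3)) auto
  qed (use insert.prems(1) in auto)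
  finally show ?case using insert.hyps by simp
qed

section \<open>Bounds for exp and for the number of successes among independent coins\<close>

lemma exp_ge_square:
  assumes "0 \<le> (x::real)" shows "x\<^sup>2 / 2 \<le> exp x"
  using exp_lower_Taylor_quadratic[OF assms] assms by linarith

text \<open>The maximum, at \<open>x = 1\<close>, is \<open>exp (-1)\<close>. The rational bound
  satisfies \<open>5/4 * (2/5) = 1/2\<close>, which later keeps a failure probability in the range
  of \<open>exp_le_one_minus\<close>.\<close>

lemma mult_exp_minus_le:
  "x * exp (- x) \<le> 2/5" for x :: real
proof -
  have "1 + (x - 1) \<le> exp (x - 1)" by (rule exp_ge_add_one_self)
  moreover have "exp (x - 1) = exp x * exp (-1)" by (simp add: exp_diff exp_minus divide_inverse)
  moreover have "exp (-1::real) \<le> 2/5"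
    using exp_lower_Taylor_quadratic[of "1::real"] by (simp add: exp_minus field_simps)
  ultimately have "x \<le> exp x * (2/5)"
    by (smt (verit) exp_gt_zero mult_left_mono)
  then show ?thesis by (simp add: exp_minus field_simps)
qed

text \<open>Turns a success probability \<open>1 - q\<close> into an exponential, so that products
  over colour classes become sums in the exponent.\<close>

lemma exp_le_one_minus:
  assumes "0 \<le> q" "q \<le> (1/2::real)" shows "exp (- (2 * q)) \<le> 1 - q"
proof -
  have "- (2 * q) \<le> - q - 2 * q\<^sup>2" using assms mult_left_mono[of "2 * q" 1 q] by (simp add: power2_eq_square)
  also have "\<dots> \<le> ln (1 - q)" using ln_one_minus_pos_lower_bound[of q] assms by simp
  finally show ?thesis using assms by (simp add: ln_ge_iff)
qed

lemma prob_Pi_bernoulli_none: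
  assumes E: "finite E" and C: "C \<subseteq> E"
    and p: "\<And>e. e \<in> E \<Longrightarrow> 0 \<le> p e \<and> p e \<le> (1/8::real)"
  shows "measure_pmf.prob (Pi_pmf E False (\<lambda>e. bernoulli_pmf (p e))) {f. \<forall>e\<in>C. \<not> f e}
    \<le> exp (- (\<Sum>e\<in>C. p e))"
proof -
  let ?P = "measure_pmf.prob (Pi_pmf E False (\<lambda>e. bernoulli_pmf (p e)))"
  have "{f. \<forall>e\<in>C. \<not> f e} = Pi E (\<lambda>e. if e \<in> C then {False} else UNIV)"
    using C by (auto simp: Pi_def)
  then have "?P {f. \<forall>e\<in>C. \<not> f e} =
      (\<Prod>e\<in>E. measure_pmf.prob (bernoulli_pmf (p e)) (if e \<in> C then {False} else UNIV))"
    by (simp add: measure_Pi_pmf_Pi E)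
  also have "\<dots> \<le> (\<Prod>e\<in>E. if e \<in> C then exp (- p e) else 1)"
  proof (rule prod_mono, safe)
    fix e assume e: "e \<in> E"
    have "1 - p e \<le> exp (- p e)" using exp_ge_add_one_self[of "- p e"] by simp
    then show "measure_pmf.prob (bernoulli_pmf (p e)) (if e \<in> C then {False} else UNIV)
        \<le> (if e \<in> C then exp (- p e) else 1)"
      using p[OF e] by (simp add: measure_pmf_single)
  qed simp
  also have "\<dots> = exp (- (\<Sum>e\<in>C. p e))"
    using C E by (simp add: prod.If_cases Int_absorb1 exp_sum sum_negf[symmetric] finite_subset[OF C E] del: sum_negf)
  finally show ?thesis .
qed

text \<open>Union bound over the single successful coordinate \<open>e\<close>. Leaving
  \<open>e\<close> out of the product over the others costs a factor \<open>exp (p e)\<close>, which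
  \<open>p e \<le> 1/8\<close> keeps below \<open>5/4\<close>.\<close>

lemma prob_Pi_bernoulli_one:
  assumes E: "finite E" and C: "C \<subseteq> E"
    and p: "\<And>e. e \<in> E \<Longrightarrow> 0 \<le> p e \<and> p e \<le> (1/8::real)"
  defines "x \<equiv> \<Sum>e\<in>C. p e"
  shows "measure_pmf.prob (Pi_pmf E False (\<lambda>e. bernoulli_pmf (p e))) {f. card {e\<in>C. f e} = 1}
    \<le> 5/4 * (x * exp (- x))"
proof -
  let ?P = "measure_pmf.prob (Pi_pmf E False (\<lambda>e. bernoulli_pmf (p e)))"
  have fC: "finite C" using E C finite_subset by blast
  have one: "?P {f. f e \<and> (\<forall>e'\<in>C - {e}. \<not> f e')} \<le> p e * (exp (- x) * (5/4))" if e: "e \<in> C" for e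
  proof -
    have eE: "e \<in> E" using e C by blast
    have "?P {f. f e \<and> (\<forall>e'\<in>C - {e}. \<not> f e')} = ?P {f. f e} * ?P {f. \<forall>e'\<in>C - {e}. \<not> f e'}"
      by (rule prob_Pi_pmf_conj[where A = "{e}"]) (use E eE C in auto)
    also have "?P {f. f e} = p e"
    proof -
      have "?P {f. f e} = measure_pmf.prob (map_pmf (\<lambda>f. f e) (Pi_pmf E False (\<lambda>e. bernoulli_pmf (p e)))) {True}"
        by (simp add: vimage_def)
      also have "\<dots> = p e"
        using p[OF eE] eE E by (subst Pi_pmf_component) (auto simp: measure_pmf_single)
      finally show ?thesis .
    qed
    also have "?P {f. \<forall>e'\<in>C - {e}. \<not> f e'} \<le> exp (- (\<Sum>e'\<in>C - {e}. p e'))"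
      by (rule prob_Pi_bernoulli_none) (use E C p in auto)
    also have "(\<Sum>e'\<in>C - {e}. p e') = x - p e"
      using fC e by (simp add: x_def sum_diff1)
    also have "exp (- (x - p e)) = exp (- x) * exp (p e)"
      by (simp add: exp_add[symmetric])
    also have "exp (p e) \<le> 5/4"
    proof -
      have "4/5 \<le> exp (- p e)" using exp_ge_add_one_self[of "- p e"] p[OF eE] by linarith
      then show ?thesis by (simp add: exp_minus field_simps)
    qed
    finally show ?thesis using p[OF eE] by (simp add: mult_left_mono)
  qed
  have "{f. card {e\<in>C. f e} = 1} \<subseteq> (\<Union>e\<in>C. {f. f e \<and> (\<forall>e'\<in>C - {e}. \<not> f e')})"
    unfolding card_1_singleton_iff One_nat_def by blast
  then have "?P {f. card {e\<in>C. f e} = 1} \<le> ?P (\<Union>e\<in>C. {f. f e \<and> (\<forall>e'\<in>C - {e}. \<not> f e')})"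
    by (intro measure_pmf.finite_measure_mono) auto
  also have "\<dots> \<le> (\<Sum>e\<in>C. ?P {f. f e \<and> (\<forall>e'\<in>C - {e}. \<not> f e')})"
    by (rule measure_pmf.finite_measure_subadditive_finite) (use fC in auto)
  also have "\<dots> \<le> (\<Sum>e\<in>C. p e * (exp (- x) * (5/4)))"
    by (rule sum_mono) (rule one)
  also have "\<dots> = 5/4 * (x * exp (- x))"
    by (simp only: sum_distrib_right[symmetric] x_def[symmetric] mult_ac)
  finally show ?thesis .
qed

text \<open>The flag \<open>b\<close> marks classes that may have been truncated, for which seeing
  no element is a failure too. Either way the failure probability is at most some \<open>q\<close>
  with \<open>q \<le> 3 * (x * exp (- x))\<close> and \<open>q \<le> 1/2\<close>, and
  \<open>exp (- (2 * q)) \<le> 1 - q\<close> finishes.\<close>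

lemma prob_Pi_bernoulli_not_one:
  assumes E: "finite E" and C: "C \<subseteq> E"
    and p: "\<And>e. e \<in> E \<Longrightarrow> 0 \<le> p e \<and> p e \<le> (1/8::real)"
  defines "x \<equiv> \<Sum>e\<in>C. p e"
  assumes b: "b \<Longrightarrow> 12 \<le> x"
  shows "exp (- (6 * (x * exp (- x)))) \<le>
    measure_pmf.prob (Pi_pmf E False (\<lambda>e. bernoulli_pmf (p e)))
      {f. card {e\<in>C. f e} \<noteq> 1 \<and> (b \<longrightarrow> (\<exists>e\<in>C. f e))}"
proof -
  let ?P = "measure_pmf.prob (Pi_pmf E False (\<lambda>e. bernoulli_pmf (p e)))"
  let ?G = "{f. card {e\<in>C. f e} \<noteq> 1 \<and> (b \<longrightarrow> (\<exists>e\<in>C. f e))}"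
  have x0: "0 \<le> x" unfolding x_def using p C by (intro sum_nonneg) auto
  have one: "?P {f. card {e\<in>C. f e} = 1} \<le> 5/4 * (x * exp (- x))"
    using prob_Pi_bernoulli_one[OF E C p] by (simp add: x_def)
  have none: "?P {f. \<forall>e\<in>C. \<not> f e} \<le> exp (- x)"
    using prob_Pi_bernoulli_none[OF E C p] by (simp add: x_def)
  obtain q where q: "?P (- ?G) \<le> q" "q \<le> 3 * (x * exp (- x))" "q \<le> 1/2"
  proof (cases b)
    case True
    have "- ?G \<subseteq> {f. card {e\<in>C. f e} = 1} \<union> {f. \<forall>e\<in>C. \<not> f e}" by auto
    then have "?P (- ?G) \<le> ?P ({f. card {e\<in>C. f e} = 1} \<union> {f. \<forall>e\<in>C. \<not> f e})"
      by (intro measure_pmf.finite_measure_mono) auto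
    also have "\<dots> \<le> ?P {f. card {e\<in>C. f e} = 1} + ?P {f. \<forall>e\<in>C. \<not> f e}"
      by (rule measure_subadditive) (auto simp: measure_pmf.emeasure_finite)
    also have "\<dots> \<le> 5/4 * (x * exp (- x)) + exp (- x)" using one none by linarith
    finally have "?P (- ?G) \<le> 5/4 * (x * exp (- x)) + exp (- x)" .
    moreover have "exp (- x) \<le> x * exp (- x)" using b[OF True] by simp
    moreover have "0 \<le> x * exp (- x)" using x0 by simp
    ultimately have 1: "?P (- ?G) \<le> 3 * (x * exp (- x))" by linarith
    \<comment> \<open>The threshold 12 enters here: together with \<open>12 \<le> x\<close> this
      gives \<open>x * exp (- x) \<le> 1/6\<close>, so three times that is at most
      \<open>1/2\<close>.\<close>
    have "x\<^sup>2 * exp (- x) \<le> 2" using exp_ge_square[OF x0] by (simp add: exp_minus field_simps)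
    moreover have "12 * (x * exp (- x)) \<le> x * (x * exp (- x))"
      using b[OF True] x0 by (intro mult_right_mono) auto
    ultimately have "3 * (x * exp (- x)) \<le> 1/2" by (simp add: power2_eq_square mult_ac)
    with 1 show ?thesis by (intro that[of "3 * (x * exp (- x))"]) auto
  next
    case False
    then have "- ?G = {f. card {e\<in>C. f e} = 1}" by auto
    then show ?thesis using one mult_exp_minus_le[of x] x0
      by (intro that[of "5/4 * (x * exp (- x))"]) auto
  qed
  have q0: "0 \<le> q" using q(1) measure_nonneg order_trans by blast
  have "?P (- ?G) = 1 - ?P ?G"
    using measure_pmf.prob_compl[of ?G] by (simp add: Compl_eq_Diff_UNIV)
  then have "1 - q \<le> ?P ?G" using q by linarith
  moreover have "exp (- (2 * q)) \<le> 1 - q" by (rule exp_le_one_minus) (use q0 q in auto)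
  moreover have "exp (- (6 * (x * exp (- x)))) \<le> exp (- (2 * q))" using q by simp
  ultimately show ?thesis by linarith
qed

subsection \<open>The random graph\<close>

text \<open>Each term obeys \<open>x * exp (- x) \<le> 2 * (exp (- (x / 2)) - exp (- x))\<close>,
  and under repeated halving the right sides telescope. The bound is free of both \<open>y\<close>
  and \<open>L\<close>.\<close>

lemma sum_dyadic_mult_exp_minus_le:
  assumes "0 \<le> (y::real)"
  shows "(\<Sum>i<L. y / 2 ^ i * exp (- (y / 2 ^ i))) \<le> 2"
proof -
  have "x * exp (- x) \<le> 2 * (exp (- (x / 2)) - exp (- x))" for x :: real
  proof -
    have "(1 + x / 2) * exp (- x) \<le> exp (x / 2) * exp (- x)"
      by (intro mult_right_mono exp_ge_add_one_self) auto
    also have "exp (x / 2) * exp (- x) = exp (- (x / 2))"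
      by (simp flip: exp_add)
    finally show ?thesis by (simp add: algebra_simps)
  qed
  from this[of "y / 2 ^ i" for i]
  have "(\<Sum>i<L. y / 2 ^ i * exp (- (y / 2 ^ i)))
      \<le> (\<Sum>i<L. 2 * (exp (- (y / 2 ^ Suc i)) - exp (- (y / 2 ^ i))))"
    by (intro sum_mono) (simp add: mult.commute)
  also have "\<dots> = 2 * (exp (- (y / 2 ^ L)) - exp (- y))"
    using sum_lessThan_telescope[of "\<lambda>i. exp (- (y / 2 ^ i))" L] by (simp only: sum_distrib_left[symmetric]) simp
  also have "\<dots> \<le> 2"
    using assms by (smt (verit) divide_nonneg_pos exp_gt_zero exp_le_one_iff zero_less_power)
  finally show ?thesis .
qed

text \<open>A set of at most \<open>Suc T\<close> elements is one of at most \<open>T\<close>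
  elements plus an optional further element, so each increment of \<open>T\<close> costs a factor
  \<open>card A + 1\<close>.\<close>

lemma card_small_subsets_le:
  assumes A: "finite A"
  shows "card {S. S \<subseteq> A \<and> card S \<le> T} \<le> (card A + 1) ^ T"
proof (induction T)
  case 0
  have "{S. S \<subseteq> A \<and> card S \<le> 0} = {{}}" using A by (auto dest: finite_subset)
  then show ?case by simp
next
  case (Suc T)
  let ?F = "\<lambda>T. {S. S \<subseteq> A \<and> card S \<le> T}" and ?g = "\<lambda>(S, a). S \<union> set_option a"
  have fin: "finite (?F T)" using A by simp
  have "?F (Suc T) \<subseteq> ?g ` (?F T \<times> insert None (Some ` A))"
  proof safe
    fix S assume S: "S \<subseteq> A" "card S \<le> Suc T"
    show "S \<in> ?g ` (?F T \<times> insert None (Some ` A))"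
    proof (cases "S = {}")
      case True
      then show ?thesis by (intro image_eqI[of _ _ "({}, None)"]) auto
    next
      case False
      then obtain a where a: "a \<in> S" by blast
      have "card (S - {a}) \<le> T" using S a A finite_subset by (simp add: card_Diff_singleton)
      then show ?thesis using S a by (intro image_eqI[of _ _ "(S - {a}, Some a)"]) auto
    qed
  qed
  then have "card (?F (Suc T)) \<le> card (?F T \<times> insert None (Some ` A))"
    using fin A by (intro surj_card_le) auto
  also have "\<dots> = card (?F T) * (card A + 1)"
    using A by (simp add: card_cartesian_product card_insert_if card_image image_iff)
  also have "\<dots> \<le> (card A + 1) ^ T * (card A + 1)"
    using Suc.IH by (rule mult_right_mono) simp
  finally show ?case by (simp add: mult.commute)
qed

section \<open>Edge coins, expected neighbour counts and truncated families\<close>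

definition edge_sets :: "'a set \<Rightarrow> 'a set set" where
  "edge_sets V = {e. \<exists>u v. u \<in> V \<and> v \<in> V \<and> u \<noteq> v \<and> e = {u, v}}"

lemma finite_edge_sets: "finite V \<Longrightarrow> finite (edge_sets V)"
  by (rule finite_subset[of _ "Pow V"]) (auto simp: edge_sets_def)

text \<open>The product of the endpoint weights \<open>(1/2) ^ lev u\<close>, scaled by
  \<open>1/8\<close> so that the coin estimates apply.\<close>

definition edge_prob :: "('a \<Rightarrow> nat) \<Rightarrow> 'a set \<Rightarrow> real" where
  "edge_prob lev e = (1/2) ^ ((\<Sum>u\<in>e. lev u) + 3)"

lemma edge_prob_bounds: "0 \<le> edge_prob lev e \<and> edge_prob lev e \<le> 1/8"
  using power_decreasing[of 3 "(\<Sum>u\<in>e. lev u) + 3" "1/2 :: real"]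
  by (simp add: edge_prob_def power3_eq_cube)

definition random_edges :: "('a \<Rightarrow> nat) \<Rightarrow> 'a set \<Rightarrow> ('a set \<Rightarrow> bool) pmf" where
  "random_edges lev V = Pi_pmf (edge_sets V) False (\<lambda>e. bernoulli_pmf (edge_prob lev e))"

definition star :: "'a \<Rightarrow> 'a set \<Rightarrow> 'a set set" where
  "star v C = (\<lambda>u. {v, u}) ` C"

text \<open>The expected number of neighbours in \<open>C\<close> of a level \<open>i\<close> vertex
  outside \<open>C\<close>. Indexing by the level makes one value serve all vertices of that
  level.\<close>

definition mean_nbrs :: "('a \<Rightarrow> nat) \<Rightarrow> nat \<Rightarrow> 'a set \<Rightarrow> real" where
  "mean_nbrs lev i C = (\<Sum>u\<in>C. (1/2) ^ (i + lev u + 3))"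

text \<open>For \<open>v \<notin> C\<close> this says that a colour class containing \<open>C\<close> (or equal to \<open>C\<close> when \<open>card C < T\<close>)
  does not serve \<open>v\<close>.\<close>
definition avoids_unique :: "nat \<Rightarrow> ('a set \<Rightarrow> bool) \<Rightarrow> 'a \<Rightarrow> 'a set \<Rightarrow> bool" where
  "avoids_unique T f v C \<longleftrightarrow> card {u \<in> C. f {v, u}} \<noteq> 1 \<and> (T \<le> card C \<longrightarrow> (\<exists>u\<in>C. f {v, u}))"

text \<open>The range of the union bound: truncated colour classes standing in for a colouring with
  at most \<open>K\<close> colours.\<close>

definition small_families :: "'a set \<Rightarrow> nat \<Rightarrow> nat \<Rightarrow> 'a set set set" where
  "small_families V T K = {\<D>. \<D> \<subseteq> {C. C \<subseteq> V \<and> card C \<le> T} \<and> disjoint \<D> \<and> card \<D> \<le> K}"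

lemma star_subset: "v \<in> V \<Longrightarrow> C \<subseteq> V \<Longrightarrow> v \<notin> C \<Longrightarrow> star v C \<subseteq> edge_sets V"
  unfolding star_def edge_sets_def by blast

lemma inj_on_pair_set: "v \<notin> C \<Longrightarrow> inj_on (\<lambda>u. {v, u}) C"
  by (auto simp: inj_on_def doubleton_eq_iff)

lemma sum_edge_prob_star:
  assumes "v \<notin> C" shows "(\<Sum>e\<in>star v C. edge_prob lev e) = mean_nbrs lev (lev v) C"
proof -
  have "(\<Sum>e\<in>star v C. edge_prob lev e) = (\<Sum>u\<in>C. edge_prob lev {v, u})"
    unfolding star_def by (subst sum.reindex) (use assms in \<open>auto intro: inj_on_pair_set\<close>)
  also have "\<dots> = mean_nbrs lev (lev v) C"
    unfolding mean_nbrs_def using assms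
    by (intro sum.cong) (auto simp: edge_prob_def sum.insert_if)
  finally show ?thesis .
qed

lemma mean_nbrs_eq: "mean_nbrs lev i C = mean_nbrs lev 0 C / 2 ^ i"
  by (simp add: mean_nbrs_def sum_divide_distrib power_add power_divide mult_ac)

lemma mean_nbrs_nonneg: "0 \<le> mean_nbrs lev i C"
  by (simp add: mean_nbrs_def sum_nonneg)

lemma mean_nbrs_ge:
  assumes "i < L" "\<And>u. u \<in> C \<Longrightarrow> lev u < L"
  shows "real (card C) * (1/2) ^ (2 * L + 1) \<le> mean_nbrs lev i C"
proof -
  \<comment> \<open>Both levels are at most \<open>L - 1\<close>, so the exponent is at most
    \<open>2 * (L - 1) + 3 = 2 * L + 1\<close>.\<close>
  have "(1/2) ^ (2 * L + 1) \<le> (1/2 :: real) ^ (i + lev u + 3)" if "u \<in> C" for u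
    using assms(1) assms(2)[OF that] by (intro power_decreasing) auto
  then have "(\<Sum>u\<in>C. (1/2) ^ (2 * L + 1)) \<le> mean_nbrs lev i C"
    unfolding mean_nbrs_def by (rule sum_mono)
  then show ?thesis by simp
qed

section \<open>Testing vertices against truncated families\<close>

context
  fixes V :: "'a set" and lev :: "'a \<Rightarrow> nat" and L T :: nat
  assumes V: "finite V" and lev: "\<And>v. v \<in> V \<Longrightarrow> lev v < L" and T: "24 * 4 ^ L \<le> T"
begin

text \<open>Since \<open>v \<notin> C\<close>, the neighbours of \<open>v\<close> in
  \<open>C\<close> correspond bijectively to the successful coins in \<open>star v C\<close>, and
  the coin estimate applies with \<open>T \<le> card C\<close> as its flag.\<close>

lemma prob_avoids_unique_class:
  assumes v: "v \<in> V" and C: "C \<subseteq> V" "v \<notin> C"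
  defines "x \<equiv> mean_nbrs lev (lev v) C"
  shows "exp (- (6 * (x * exp (- x)))) \<le> measure_pmf.prob (random_edges lev V) {f. avoids_unique T f v C}"
proof -
  have "avoids_unique T f v C \<longleftrightarrow>
      card {e \<in> star v C. f e} \<noteq> 1 \<and> (T \<le> card C \<longrightarrow> (\<exists>e\<in>star v C. f e))" for f
  proof -
    have "{e \<in> star v C. f e} = (\<lambda>u. {v, u}) ` {u \<in> C. f {v, u}}"
      by (auto simp: star_def)
    then have "card {e \<in> star v C. f e} = card {u \<in> C. f {v, u}}"
      using card_image[OF inj_on_subset[OF inj_on_pair_set[OF C(2)], of "{u \<in> C. f {v, u}}"]] by simp
    then show ?thesis by (auto simp: avoids_unique_def star_def)
  qed
  moreover have "12 \<le> (\<Sum>e\<in>star v C. edge_prob lev e)" if "T \<le> card C"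
  proof -
    \<comment> \<open>This calibrates \<open>T\<close>: edge probabilities inside \<open>V\<close>
      are at least \<open>(1/2) ^ (2 * L + 1)\<close>, so \<open>T\<close> vertices have mean at
      least 12.\<close>
    have "12 = real (24 * 4 ^ L) * (1/2) ^ (2 * L + 1)"
      by (simp add: power_mult power_divide)
    also have "\<dots> \<le> real (card C) * (1/2) ^ (2 * L + 1)"
      using that T by (intro mult_right_mono) (simp_all only: of_nat_le_iff, auto)
    also have "\<dots> \<le> mean_nbrs lev (lev v) C"
      using lev v C by (intro mean_nbrs_ge) auto
    finally show ?thesis using C by (simp add: sum_edge_prob_star)
  qed
  ultimately show ?thesis
    using prob_Pi_bernoulli_not_one[of "edge_sets V" "star v C" "edge_prob lev" "T \<le> card C"]
      finite_edge_sets[OF V] star_subset[OF v C] edge_prob_bounds[of lev] C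
    by (simp add: random_edges_def x_def sum_edge_prob_star)
qed

lemma avoids_unique_cong:
  assumes "\<forall>e\<in>star v C. f e = g e" shows "avoids_unique T f v C = avoids_unique T g v C"
proof -
  have "f {v, u} = g {v, u}" if "u \<in> C" for u using assms that by (auto simp: star_def)
  then have "{u \<in> C. f {v, u}} = {u \<in> C. g {v, u}}" "(\<exists>u\<in>C. f {v, u}) = (\<exists>u\<in>C. g {v, u})"
    by auto
  then show ?thesis by (simp add: avoids_unique_def)
qed

text \<open>Disjoint classes have disjoint stars at \<open>v\<close>, so their events are
  independent and the exponents of the single-class bounds add up.\<close>

lemma prob_avoids_unique_family:
  assumes v: "v \<in> V" "v \<notin> \<Union>\<D>" and \<D>: "\<Union>\<D> \<subseteq> V" "finite \<D>" "disjoint \<D>"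
  defines "s \<equiv> \<Sum>C\<in>\<D>. mean_nbrs lev (lev v) C * exp (- mean_nbrs lev (lev v) C)"
  shows "exp (- (6 * s)) \<le> measure_pmf.prob (random_edges lev V) {f. \<forall>C\<in>\<D>. avoids_unique T f v C}"
proof -
  have "measure_pmf.prob (random_edges lev V) {f. \<forall>C\<in>\<D>. avoids_unique T f v C} =
      (\<Prod>C\<in>\<D>. measure_pmf.prob (random_edges lev V) {f. avoids_unique T f v C})"
    unfolding random_edges_def
  proof (rule prob_Pi_pmf_Ball[where A = "star v"])
    show "star v C \<subseteq> edge_sets V" if "C \<in> \<D>" for C
      using that v \<D> by (intro star_subset) auto
    show "disjoint_family_on (star v) \<D>"
      unfolding disjoint_family_on_def
    proof (intro ballI impI)
      fix C C' assume C: "C \<in> \<D>" "C' \<in> \<D>" "C \<noteq> C'"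
      then have "C \<inter> C' = {}" using \<D>(3) by (simp add: disjointD)
      then show "star v C \<inter> star v C' = {}"
        using C v(2) by (auto simp: star_def doubleton_eq_iff)
    qed
  qed (use V \<D>(2) finite_edge_sets in \<open>simp_all add: avoids_unique_cong\<close>)
  moreover have "exp (- (6 * s)) = (\<Prod>C\<in>\<D>. exp (- (6 * (mean_nbrs lev (lev v) C * exp (- mean_nbrs lev (lev v) C)))))"
    using \<D>(2) by (simp add: s_def exp_sum[symmetric] sum_negf sum_distrib_left)
  moreover have "\<dots> \<le> (\<Prod>C\<in>\<D>. measure_pmf.prob (random_edges lev V) {f. avoids_unique T f v C})"
    using v \<D> by (intro prod_mono conjI prob_avoids_unique_class) auto
  ultimately show ?thesis by simp
qed

text \<open>The tested vertices lie outside \<open>\<Union>\<D>\<close>, so a coin joining two of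
  them is read by neither test. Hence the tests read disjoint sets of coins and fail independently,
  and each failure has probability at most \<open>1 - p \<le> exp (- p)\<close> for
  \<open>p = exp (- (6 * s))\<close>.\<close>

lemma prob_no_avoids_unique_vertex:
  assumes \<D>: "\<Union>\<D> \<subseteq> V" "finite \<D>" "disjoint \<D>"
    and B: "B \<subseteq> V - \<Union>\<D>" "\<And>v. v \<in> B \<Longrightarrow> lev v = i"
  defines "s \<equiv> \<Sum>C\<in>\<D>. mean_nbrs lev i C * exp (- mean_nbrs lev i C)"
  shows "measure_pmf.prob (random_edges lev V) {f. \<forall>v\<in>B. \<not> (\<forall>C\<in>\<D>. avoids_unique T f v C)}
    \<le> exp (- (exp (- (6 * s)) * real (card B)))"
proof -
  let ?P = "measure_pmf.prob (random_edges lev V)"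
  have fB: "finite B" using B V finite_subset by blast
  have "?P {f. \<forall>v\<in>B. \<not> (\<forall>C\<in>\<D>. avoids_unique T f v C)} = (\<Prod>v\<in>B. ?P {f. \<not> (\<forall>C\<in>\<D>. avoids_unique T f v C)})"
    unfolding random_edges_def
  proof (rule prob_Pi_pmf_Ball[where A = "\<lambda>v. star v (\<Union>\<D>)"])
    show "star v (\<Union>\<D>) \<subseteq> edge_sets V" if "v \<in> B" for v
      using that \<D> B by (intro star_subset) auto
    show "disjoint_family_on (\<lambda>v. star v (\<Union>\<D>)) B"
      unfolding disjoint_family_on_def
    proof (intro ballI impI)
      fix v w assume "v \<in> B" "w \<in> B" "v \<noteq> w"
      then have "v \<notin> \<Union>\<D>" "w \<notin> \<Union>\<D>" "v \<noteq> w" using B(1) by auto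
      then show "star v (\<Union>\<D>) \<inter> star w (\<Union>\<D>) = {}"
        by (auto simp: star_def doubleton_eq_iff)
    qed
    show "(\<not> (\<forall>C\<in>\<D>. avoids_unique T f v C)) = (\<not> (\<forall>C\<in>\<D>. avoids_unique T g v C))"
      if "v \<in> B" "\<forall>e\<in>star v (\<Union>\<D>). f e = g e" for v f g
    proof -
      have "avoids_unique T f v C = avoids_unique T g v C" if "C \<in> \<D>" for C
        by (rule avoids_unique_cong) (use \<open>\<forall>e\<in>star v (\<Union>\<D>). f e = g e\<close> that in \<open>auto simp: star_def\<close>)
      then show ?thesis by blast
    qed
  qed (use V fB finite_edge_sets in simp_all)
  also have "\<dots> \<le> (\<Prod>v\<in>B. exp (- exp (- (6 * s))))"
  proof (intro prod_mono conjI measure_nonneg)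
    fix v assume v: "v \<in> B"
    have "exp (- (6 * s)) \<le> ?P {f. \<forall>C\<in>\<D>. avoids_unique T f v C}"
      using prob_avoids_unique_family[of v \<D>] v B \<D> by (auto simp: s_def)
    moreover have "?P {f. \<not> (\<forall>C\<in>\<D>. avoids_unique T f v C)} = 1 - ?P {f. \<forall>C\<in>\<D>. avoids_unique T f v C}"
      using measure_pmf.prob_compl[of "{f. \<forall>C\<in>\<D>. avoids_unique T f v C}" "random_edges lev V"]
      by (simp only: Compl_eq_Diff_UNIV[symmetric] Collect_neg_eq space_measure_pmf sets_measure_pmf UNIV_I)
    moreover have "1 + (- exp (- (6 * s))) \<le> exp (- exp (- (6 * s)))" by (rule exp_ge_add_one_self)
    ultimately show "?P {f. \<not> (\<forall>C\<in>\<D>. avoids_unique T f v C)} \<le> exp (- exp (- (6 * s)))" by linarith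
  qed
  also have "\<dots> = exp (- (exp (- (6 * s)) * real (card B)))"
    using exp_of_nat_mult[of "card B" "- exp (- (6 * s))"] by (simp add: mult.commute)
  finally show ?thesis .
qed

text \<open>Averaging: after exchanging the sums, each class contributes at most 2 over all levels
  by the dyadic bound, so some level gets no more than the mean.\<close>

lemma exists_level:
  assumes "finite \<D>" "0 < L"
  shows "\<exists>i<L. (\<Sum>C\<in>\<D>. mean_nbrs lev i C * exp (- mean_nbrs lev i C)) \<le> 2 * real (card \<D>) / real L"
proof (rule ccontr)
  assume "\<not> ?thesis"
  then have "2 * real (card \<D>) / real L < (\<Sum>C\<in>\<D>. mean_nbrs lev i C * exp (- mean_nbrs lev i C))"
    if "i < L" for i
    using that by auto
  then have "(\<Sum>i<L. 2 * real (card \<D>) / real L) < (\<Sum>i<L. \<Sum>C\<in>\<D>. mean_nbrs lev i C * exp (- mean_nbrs lev i C))"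
    using assms(2) by (intro sum_strict_mono) (auto simp: lessThan_empty_iff)
  also have "\<dots> = (\<Sum>C\<in>\<D>. \<Sum>i<L. mean_nbrs lev i C * exp (- mean_nbrs lev i C))"
    by (rule sum.swap)
  also have "\<dots> \<le> (\<Sum>C\<in>\<D>. 2)"
    using sum_dyadic_mult_exp_minus_le[OF mean_nbrs_nonneg[of lev 0]]
    by (intro sum_mono) (simp flip: mean_nbrs_eq)
  finally show False using assms(2) by simp
qed

text \<open>Only the level supplied by \<open>exists_level\<close> is tested; there six times the
  sum is at most \<open>12 * K / L\<close>. The family covers at most \<open>T * K\<close> vertices,
  so at least \<open>M - T * K\<close> independent tests remain.\<close>

lemma prob_family_fails:
  assumes \<D>: "\<Union>\<D> \<subseteq> V" "finite \<D>" "disjoint \<D>" "card \<D> \<le> K" "\<And>C. C \<in> \<D> \<Longrightarrow> card C \<le> T"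
    and M: "\<And>i. i < L \<Longrightarrow> M \<le> card {v \<in> V. lev v = i}" and L: "0 < L"
  shows "measure_pmf.prob (random_edges lev V) {f. \<forall>v\<in>V - \<Union>\<D>. \<not> (\<forall>C\<in>\<D>. avoids_unique T f v C)}
    \<le> exp (- (exp (- (12 * real K / real L)) * (real M - real T * real K)))"
proof -
  let ?P = "measure_pmf.prob (random_edges lev V)"
  obtain i where i: "i < L"
    "(\<Sum>C\<in>\<D>. mean_nbrs lev i C * exp (- mean_nbrs lev i C)) \<le> 2 * real (card \<D>) / real L" (is "?s \<le> _")
    using exists_level[OF \<D>(2) L] by blast
  let ?B = "{v \<in> V. lev v = i} - \<Union>\<D>"
  have s: "exp (- (12 * real K / real L)) \<le> exp (- (6 * ?s))"
  proof -
    have "2 * real (card \<D>) / real L \<le> 2 * real K / real L"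
      using \<D>(4) by (intro divide_right_mono) auto
    then show ?thesis using i(2) by simp
  qed
  have "card (\<Union>\<D>) \<le> (\<Sum>C\<in>\<D>. card C)" by (rule card_Union_le_sum_card)
  also have "\<dots> \<le> card \<D> * T" using \<D>(5) by (metis sum_bounded_above of_nat_id)
  also have "\<dots> \<le> K * T" using \<D>(4) by simp
  finally have "card (\<Union>\<D>) \<le> K * T" .
  moreover have "card {v \<in> V. lev v = i} - card (\<Union>\<D>) \<le> card ?B"
    by (rule diff_card_le_card_Diff) (use \<D> V finite_subset in blast)
  ultimately have "M \<le> card ?B + K * T" using M[OF i(1)] by linarith
  then have "real M \<le> real (card ?B + K * T)" by (simp only: of_nat_le_iff)
  then have B: "real M - real T * real K \<le> real (card ?B)" by (simp add: mult.commute)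
  have "?P {f. \<forall>v\<in>V - \<Union>\<D>. \<not> (\<forall>C\<in>\<D>. avoids_unique T f v C)} \<le> ?P {f. \<forall>v\<in>?B. \<not> (\<forall>C\<in>\<D>. avoids_unique T f v C)}"
    by (intro measure_pmf.finite_measure_mono) auto
  also have "\<dots> \<le> exp (- (exp (- (6 * ?s)) * real (card ?B)))"
    by (rule prob_no_avoids_unique_vertex) (use \<D> in auto)
  also have "\<dots> \<le> exp (- (exp (- (12 * real K / real L)) * (real M - real T * real K)))"
  proof -
    have "exp (- (12 * real K / real L)) * (real M - real T * real K) \<le> exp (- (12 * real K / real L)) * real (card ?B)"
      using B by (intro mult_left_mono) auto
    also have "\<dots> \<le> exp (- (6 * ?s)) * real (card ?B)" using s by (intro mult_right_mono) auto
    finally show ?thesis by simp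
  qed
  finally show ?thesis .
qed

text \<open>Union bound over all families. Small subsets are counted twice, first those of
  \<open>V\<close>, then those of the collection of admissible classes.\<close>

lemma prob_some_family_fails:
  assumes M: "\<And>i. i < L \<Longrightarrow> M \<le> card {v \<in> V. lev v = i}" and L: "0 < L"
  shows "measure_pmf.prob (random_edges lev V)
      {f. \<exists>\<D>\<in>small_families V T K. \<forall>v\<in>V - \<Union>\<D>. \<not> (\<forall>C\<in>\<D>. avoids_unique T f v C)}
    \<le> real (card V + 2) ^ (T * K) * exp (- (exp (- (12 * real K / real L)) * (real M - real T * real K)))"
proof -
  let ?P = "measure_pmf.prob (random_edges lev V)"
  let ?bd = "exp (- (exp (- (12 * real K / real L)) * (real M - real T * real K)))"
  let ?S = "{C. C \<subseteq> V \<and> card C \<le> T}"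
  have fS: "finite ?S" using V by simp
  have sub: "small_families V T K \<subseteq> {\<D>. \<D> \<subseteq> ?S \<and> card \<D> \<le> K}" by (auto simp: small_families_def)
  have fin: "finite (small_families V T K)" by (rule finite_subset[OF sub]) (use fS in simp)
  have T1: "0 < T" using T by (metis gr0I le_zero_eq mult_eq_0_iff power_eq_0_iff zero_neq_numeral)
  have "card (small_families V T K) \<le> card {\<D>. \<D> \<subseteq> ?S \<and> card \<D> \<le> K}"
    by (rule card_mono[OF _ sub]) (use fS in simp)
  also have "\<dots> \<le> (card ?S + 1) ^ K" by (rule card_small_subsets_le[OF fS])
  also have "\<dots> \<le> ((card V + 1) ^ T + 1) ^ K"
    using card_small_subsets_le[OF V] by (intro power_mono add_right_mono) auto
  also have "\<dots> \<le> ((card V + 2) ^ T) ^ K"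
  proof (rule power_mono)
    have "(card V + 1) ^ T < (card V + 2) ^ T" using T1 by (intro power_strict_mono) auto
    then show "(card V + 1) ^ T + 1 \<le> (card V + 2) ^ T" by simp
  qed simp
  finally have card: "real (card (small_families V T K)) \<le> real (card V + 2) ^ (T * K)"
    by (metis of_nat_le_iff of_nat_power power_mult)
  have "?P {f. \<exists>\<D>\<in>small_families V T K. \<forall>v\<in>V - \<Union>\<D>. \<not> (\<forall>C\<in>\<D>. avoids_unique T f v C)}
      = ?P (\<Union>\<D>\<in>small_families V T K. {f. \<forall>v\<in>V - \<Union>\<D>. \<not> (\<forall>C\<in>\<D>. avoids_unique T f v C)})"
    by (rule arg_cong[of _ _ ?P]) auto
  also have "\<dots> \<le> (\<Sum>\<D>\<in>small_families V T K. ?P {f. \<forall>v\<in>V - \<Union>\<D>. \<not> (\<forall>C\<in>\<D>. avoids_unique T f v C)})"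
    by (rule measure_pmf.finite_measure_subadditive_finite) (use fin in auto)
  also have "\<dots> \<le> (\<Sum>\<D>\<in>small_families V T K. ?bd)"
  proof (rule sum_mono)
    fix \<D> assume "\<D> \<in> small_families V T K"
    then have \<D>: "\<D> \<subseteq> ?S" "disjoint \<D>" "card \<D> \<le> K" by (auto simp: small_families_def)
    show "?P {f. \<forall>v\<in>V - \<Union>\<D>. \<not> (\<forall>C\<in>\<D>. avoids_unique T f v C)} \<le> ?bd"
      by (rule prob_family_fails) (use \<D> M L finite_subset[OF \<D>(1) fS] in auto)
  qed
  also have "\<dots> = real (card (small_families V T K)) * ?bd" by simp
  also have "\<dots> \<le> real (card V + 2) ^ (T * K) * ?bd" using card by (intro mult_right_mono) auto
  finally show ?thesis .
qed

text \<open>Serves the minimum degree: it bounds the chance that \<open>v\<close> has no neighbour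
  in a prescribed block.\<close>

lemma prob_misses_set:
  assumes v: "v \<in> V" and C: "C \<subseteq> V" "v \<notin> C"
  shows "measure_pmf.prob (random_edges lev V) {f. \<forall>u\<in>C. \<not> f {v, u}} \<le> exp (- mean_nbrs lev (lev v) C)"
  using prob_Pi_bernoulli_none[of "edge_sets V" "star v C" "edge_prob lev"]
    finite_edge_sets[OF V] star_subset[OF v C] edge_prob_bounds[of lev] C
  by (simp add: random_edges_def sum_edge_prob_star) (simp add: star_def)

end

subsection \<open>Colourings and degrees\<close>

text \<open>As \<open>f\<close> is an arbitrary predicate on sets, loops are excluded explicitly;
  symmetry is automatic because both arcs consult \<open>f {u, v}\<close>.\<close>

definition edge_graph :: "'a set \<Rightarrow> ('a set \<Rightarrow> bool) \<Rightarrow> 'a pair_pre_digraph" where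
  "edge_graph V f = \<lparr>pverts = V, parcs = {(u, v). u \<in> V \<and> v \<in> V \<and> u \<noteq> v \<and> f {u, v}}\<rparr>"

lemma pverts_edge_graph [simp]: "pverts (edge_graph V f) = V"
  by (simp add: edge_graph_def)

lemma nbhd_edge_graph: "nbhd (edge_graph V f) v = (if v \<in> V then {u \<in> V. u \<noteq> v \<and> f {v, u}} else {})"
  by (auto simp: edge_graph_def nbhd_def)

lemma pair_graph_edge_graph:
  assumes "finite V" shows "pair_graph (edge_graph V f)"
proof -
  have "parcs (edge_graph V f) \<subseteq> V \<times> V" by (auto simp: edge_graph_def)
  then have "finite (parcs (edge_graph V f))" using assms finite_subset by blast
  moreover have "sym (parcs (edge_graph V f))"
    by (auto simp: edge_graph_def sym_def insert_commute)
  ultimately show ?thesis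
    using assms by unfold_locales (auto simp: edge_graph_def symmetric_def)
qed

text \<open>A colouring with at most \<open>K\<close> colours truncates to a small family, which
  supplies a vertex \<open>v\<close>. If colour \<open>a\<close> occurred exactly once around
  \<open>v\<close>, then \<open>v\<close> would have exactly one neighbour in the truncated class of
  \<open>a\<close>, contrary to \<open>avoids_unique\<close>.\<close>

lemma cfcn_coloring_edge_graph_gt:
  assumes V: "finite V" and T: "0 < T"
    and fam: "\<And>\<D>. \<D> \<in> small_families V T K \<Longrightarrow> \<exists>v\<in>V - \<Union>\<D>. \<forall>C\<in>\<D>. avoids_unique T f v C"
    and c: "cfcn_coloring (edge_graph V f) c"
  shows "K < card (c ` V)"
proof (rule ccontr)
  assume "\<not> K < card (c ` V)"
  then have K: "card (c ` V) \<le> K" by simp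
  define cls where "cls a = {u \<in> V. c u = a}" for a
  have fin: "finite (cls a)" for a using V by (simp add: cls_def)
  have "\<exists>C. C \<subseteq> cls a \<and> card C = min T (card (cls a))" for a
    by (meson min.cobounded2 obtain_subset_with_card_n)
  then obtain tr where tr: "\<And>a. tr a \<subseteq> cls a" "\<And>a. card (tr a) = min T (card (cls a))"
    by metis
  \<comment> \<open>A truncated class with fewer than \<open>T\<close> vertices has lost nothing, so
    size alone tells complete classes from possibly cut ones.\<close>
  have small: "tr a = cls a" if "card (tr a) < T" for a
    using that tr[of a] fin[of a] by (intro card_subset_eq) auto
  have "tr ` c ` V \<in> small_families V T K"
  proof -
    have "card (tr ` c ` V) \<le> K"
      using K V card_image_le[of "c ` V" tr] by simp
    moreover have "disjoint (tr ` c ` V)"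
    proof (rule disjointI)
      fix C D assume CD: "C \<in> tr ` c ` V" "D \<in> tr ` c ` V" "C \<noteq> D"
      then obtain a b where "C = tr a" "D = tr b" by (elim imageE)
      then have "C \<subseteq> cls a" "D \<subseteq> cls b" "a \<noteq> b" using tr(1) CD(3) by auto
      then show "C \<inter> D = {}" by (auto simp: cls_def)
    qed
    moreover have "tr a \<subseteq> V \<and> card (tr a) \<le> T" for a using tr by (auto simp: cls_def)
    ultimately show ?thesis by (auto simp: small_families_def)
  qed
  from fam[OF this] obtain v where v: "v \<in> V - \<Union>(tr ` c ` V)"
      and av_all: "\<forall>C\<in>tr ` c ` V. avoids_unique T f v C"
    by (elim bexE)
  have vV: "v \<in> V" using v by (rule DiffD1)
  have av: "avoids_unique T f v (tr a)" if "a \<in> c ` V" for a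
    using bspec[OF av_all imageI[OF that]] .
  have "\<exists>a. \<exists>!u. u \<in> closed_nbhd (edge_graph V f) v \<and> c u = a"
    using c vV by (simp add: cfcn_coloring_def)
  then obtain a where "\<exists>!u. u \<in> closed_nbhd (edge_graph V f) v \<and> c u = a" by (rule exE)
  then obtain u where u_conj: "u \<in> closed_nbhd (edge_graph V f) v \<and> c u = a"
      and all: "\<forall>w. w \<in> closed_nbhd (edge_graph V f) v \<and> c w = a \<longrightarrow> w = u"
    by (rule ex1E)
  have u: "u \<in> closed_nbhd (edge_graph V f) v" "c u = a"
    using u_conj by (rule conjunct1, rule conjunct2)
  have uniq: "w = u" if "w \<in> closed_nbhd (edge_graph V f) v" "c w = a" for w
    using all[rule_format, OF conjI, OF that] .
  have cn: "closed_nbhd (edge_graph V f) v = insert v {w \<in> V. w \<noteq> v \<and> f {v, w}}"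
    using vV by (simp add: closed_nbhd_def nbhd_edge_graph)
  have uV: "u \<in> V" using u(1) vV cn by auto
  then have aV: "a \<in> c ` V" using u(2) by blast
  then have vt: "v \<notin> tr a" using DiffD2[OF v] UnionI[OF imageI] by metis
  let ?S = "{w \<in> tr a. f {v, w}}"
  have S: "?S \<subseteq> {u}"
  proof
    fix w assume w: "w \<in> ?S"
    then have "w \<in> V" "c w = a" "w \<noteq> v" using tr(1)[of a] vt by (auto simp: cls_def)
    with w show "w \<in> {u}" using uniq[of w] unfolding cn by blast
  qed
  \<comment> \<open>A truncated class of size \<open>T\<close> is seen by \<open>v\<close> through
    \<open>avoids_unique\<close>. A smaller one is the whole colour class and contains
    \<open>u\<close>; since \<open>v\<close> lies outside it, \<open>u\<close> is a proper
    neighbour.\<close>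
  have "?S \<noteq> {}"
  proof (cases "T \<le> card (tr a)")
    case True
    then show ?thesis using av[OF aV] by (auto simp: avoids_unique_def)
  next
    case False
    then have "tr a = cls a" using small by simp
    then have "u \<in> tr a" using uV u(2) by (simp add: cls_def)
    moreover have "u \<noteq> v" using \<open>u \<in> tr a\<close> vt by blast
    ultimately show ?thesis using u(1) cn by auto
  qed
  then have "?S = {u}" using S by blast
  then show False using av[OF aV] by (simp add: avoids_unique_def)
qed

lemma chi_CN_ge:
  assumes fin: "finite (pverts G)" and irr: "\<And>v. (v, v) \<notin> parcs G"
    and col: "\<And>c :: 'a \<Rightarrow> nat. cfcn_coloring G c \<Longrightarrow> K \<le> card (c ` pverts G)"
  shows "K \<le> chi_CN G"
proof -
  obtain c :: "'a \<Rightarrow> nat" where c: "inj_on c (pverts G)"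
    using fin finite_imp_inj_to_nat_seg by blast
  have "cfcn_coloring G c"
    unfolding cfcn_coloring_def
  proof
    fix v assume v: "v \<in> pverts G"
    then have "closed_nbhd G v \<subseteq> pverts G" by (auto simp: closed_nbhd_def nbhd_def)
    then have "\<exists>!u. u \<in> closed_nbhd G v \<and> c u = c v"
      using c v by (intro ex1I[of _ v]) (auto simp: closed_nbhd_def dest: inj_onD)
    then show "\<exists>a. \<exists>!u. u \<in> closed_nbhd G v \<and> c u = a" by blast
  qed
  then have "\<exists>k. \<exists>c :: 'a \<Rightarrow> nat. cfcn_coloring G c \<and> card (c ` pverts G) = k" by blast
  from LeastI_ex[OF this] show ?thesis
    unfolding chi_CN_def using col by metis
qed

text \<open>Disjoint cliques on \<open>n + 1\<close> and \<open>m + 1\<close> vertices adjust the extreme degrees.\<close>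
lemma exists_graph_with_degrees:
  fixes f :: "nat set \<Rightarrow> bool"
  assumes n: "0 < n" "m \<le> n"
    and deg: "\<And>v. v < n \<Longrightarrow> m \<le> card {u. u < n \<and> u \<noteq> v \<and> f {v, u}}"
    and col: "\<And>c :: nat \<Rightarrow> nat. cfcn_coloring (edge_graph {..<n} f) c \<Longrightarrow> K \<le> card (c ` {..<n})"
  shows "\<exists>G :: nat pair_pre_digraph. pair_graph G \<and> pverts G \<noteq> {} \<and> max_degree G = n \<and>
    min_degree G = m \<and> K \<le> chi_CN G"
proof -
  \<comment> \<open>\<open>A\<close> has \<open>n + 1\<close> and \<open>B\<close> has
    \<open>m + 1\<close> vertices, so as cliques they realise the degrees \<open>n\<close> and
    \<open>m\<close> exactly.\<close>
  define A where "A = {n..<2 * n + 1}"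
  define B where "B = {2 * n + 1..<2 * n + m + 2}"
  define V where "V = {..<n} \<union> A \<union> B"
  define g where "g e \<longleftrightarrow> e \<subseteq> {..<n} \<and> f e \<or> e \<subseteq> A \<or> e \<subseteq> B" for e
  define G where "G = edge_graph V g"
  have V: "pverts G = V" by (simp add: G_def)
  have fV: "finite V" by (simp add: V_def A_def B_def)
  have PG: "pair_graph G" unfolding G_def by (rule pair_graph_edge_graph[OF fV])
  have dj: "A \<inter> {..<n} = {}" "B \<inter> {..<n} = {}" "A \<inter> B = {}"
    by (auto simp: A_def B_def)
  have N0: "nbhd G v = {u. u < n \<and> u \<noteq> v \<and> f {v, u}}" if "v < n" for v
    using that dj by (auto simp: G_def nbhd_edge_graph g_def V_def)
  have NA: "nbhd G v = A - {v}" if "v \<in> A" for v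
    using that dj by (auto simp: G_def nbhd_edge_graph g_def V_def)
  have NB: "nbhd G v = B - {v}" if "v \<in> B" for v
    using that dj by (auto simp: G_def nbhd_edge_graph g_def V_def)
  have d0: "m \<le> card (nbhd G v) \<and> card (nbhd G v) \<le> n" if "v < n" for v
  proof -
    have "card {u. u < n \<and> u \<noteq> v \<and> f {v, u}} \<le> card {..<n}" by (rule card_mono) auto
    then show ?thesis using N0[OF that] deg[OF that] by simp
  qed
  have dA: "card (nbhd G v) = n" if "v \<in> A" for v
    using that NA[OF that] by (simp add: A_def)
  have dB: "card (nbhd G v) = m" if "v \<in> B" for v
    using that NB[OF that] by (simp add: B_def)
  have nA: "n \<in> A" and nB: "2 * n + 1 \<in> B" by (auto simp: A_def B_def)
  have degs: "m \<le> card (nbhd G v) \<and> card (nbhd G v) \<le> n" if "v \<in> V" for v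
    using that d0 dA dB n(2) unfolding V_def by (metis UnE lessThan_iff order_refl)
  have "max_degree G = n"
    unfolding max_degree_def V
    using fV degs nA dA[OF nA] by (intro Max_eqI) (auto simp: V_def image_iff intro: bexI[of _ n])
  moreover have "min_degree G = m"
    unfolding min_degree_def V
    using fV degs nB dB[OF nB] by (intro Min_eqI) (auto simp: V_def image_iff intro: bexI[of _ "2 * n + 1"])
  moreover have "K \<le> chi_CN G"
  proof (rule chi_CN_ge)
    show "finite (pverts G)" using fV V by simp
    show "(v, v) \<notin> parcs G" for v by (simp add: G_def edge_graph_def)
    fix c :: "nat \<Rightarrow> nat" assume c: "cfcn_coloring G c"
    \<comment> \<open>No edge leaves \<open>{..<n}\<close>, so a colouring of \<open>G\<close>
      restricts to one of the original graph.\<close>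
    have "closed_nbhd (edge_graph {..<n} f) v = closed_nbhd G v" if "v < n" for v
      using that N0[OF that] by (auto simp: closed_nbhd_def nbhd_edge_graph)
    then have "cfcn_coloring (edge_graph {..<n} f) c"
      using c V by (simp add: cfcn_coloring_def V_def)
    then have "K \<le> card (c ` {..<n})" by (rule col)
    also have "\<dots> \<le> card (c ` pverts G)"
      using fV V by (intro card_mono) (auto simp: V_def)
    finally show "K \<le> card (c ` pverts G)" .
  qed
  moreover have "pverts G \<noteq> {}" using nA V by (auto simp: V_def)
  ultimately show ?thesis using PG by blast
qed

subsection \<open>Choice of parameters\<close>

lemma exists_not_in_of_prob_less_1:
  assumes "measure_pmf.prob p A < 1" shows "\<exists>x. x \<notin> A"
  using assms measure_pmf.prob_space[of p] by (metis UNIV_eq_I less_irrefl space_measure_pmf)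

text \<open>Two bad events have probability below \<open>1/2\<close> each: \<open>F1\<close>, some
  small family has no vertex outside it that avoids all its classes; \<open>F2\<close>, some vertex
  has no neighbour in one of \<open>d\<close> disjoint blocks. Any \<open>f\<close> outside both
  works.\<close>

lemma exists_edge_set:
  fixes L r K :: nat
  defines "M \<equiv> 2 ^ (r * L)" and "T \<equiv> 24 * 4 ^ L" and "d \<equiv> 2 ^ ((r - 2) * L)"
  defines "n \<equiv> L * M"
  assumes L: "0 < L" and r: "2 \<le> r"
    and h1: "real (n + 2) ^ (T * K) * exp (- (exp (- (12 * real K / real L)) * (real M - real T * real K))) < 1/2"
    and h2: "real n * real d * exp (- (2 ^ L / 8)) < 1/2"
  shows "\<exists>f. (\<forall>v<n. d \<le> card {u. u < n \<and> u \<noteq> v \<and> f {v, u}}) \<and>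
    (\<forall>c :: nat \<Rightarrow> nat. cfcn_coloring (edge_graph {..<n} f) c \<longrightarrow> K < card (c ` {..<n}))"
proof -
  define V where "V = {..<n}"
  define lev where "lev v = v div M" for v
  let ?P = "measure_pmf.prob (random_edges lev V)"
  have M: "0 < M" by (simp add: M_def)
  have T: "0 < T" by (simp add: T_def)
  have lev: "lev v < L" if "v \<in> V" for v
    using that M by (simp add: lev_def V_def n_def less_mult_imp_div_less)
  have fV: "finite V" by (simp add: V_def)
  have levels: "M \<le> card {v \<in> V. lev v = i}" if "i < L" for i
  proof -
    have "{i * M..<Suc i * M} \<subseteq> {v \<in> V. lev v = i}"
    proof
      fix v assume v: "v \<in> {i * M..<Suc i * M}"
      have "Suc i * M \<le> L * M" using that by (intro mult_right_mono) auto
      moreover have "v div M = i" using v by (intro div_nat_eqI) (auto simp: mult.commute)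
      ultimately show "v \<in> {v \<in> V. lev v = i}" using v by (auto simp: V_def n_def lev_def)
    qed
    then have "card {i * M..<Suc i * M} \<le> card {v \<in> V. lev v = i}"
      using fV by (intro card_mono) auto
    then show ?thesis by simp
  qed
  define F1 where "F1 = {f. \<exists>\<D>\<in>small_families V T K. \<forall>v\<in>V - \<Union>\<D>. \<not> (\<forall>C\<in>\<D>. avoids_unique T f v C)}"
  have F1: "?P F1 < 1/2"
  proof -
    have "?P F1 \<le> real (card V + 2) ^ (T * K) * exp (- (exp (- (12 * real K / real L)) * (real M - real T * real K)))"
      unfolding F1_def by (rule prob_some_family_fails) (use fV lev levels L in \<open>auto simp: T_def\<close>)
    then show ?thesis using h1 by (simp add: V_def)
  qed
  \<comment> \<open>Level 0, which has the largest weight, is cut into \<open>d\<close> blocks of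
    \<open>4 ^ L\<close> vertices. A neighbour in every block forces degree at least
    \<open>d\<close>.\<close>
  define blk where "blk j = {j * 4 ^ L..<Suc j * 4 ^ L}" for j :: nat
  have dM: "d * 4 ^ L = M"
  proof -
    have "(r - 2) * L + 2 * L = r * L" using r by (metis add_mult_distrib le_add_diff_inverse2)
    then have "2 ^ ((r - 2) * L) * 2 ^ (2 * L) = (2 ^ (r * L) :: nat)" by (simp flip: power_add)
    then show ?thesis by (simp add: d_def M_def power_mult)
  qed
  have blk_less: "u < M" if "u \<in> blk j" "j < d" for u j
  proof -
    have "Suc j * 4 ^ L \<le> d * 4 ^ L" using that by (intro mult_right_mono) auto
    then show ?thesis using that dM by (simp add: blk_def)
  qed
  have blk_V: "blk j \<subseteq> V" if "j < d" for j
  proof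
    fix u assume "u \<in> blk j"
    then have "u < M" using blk_less that by blast
    also have "M \<le> L * M" using L by simp
    finally show "u \<in> V" by (simp add: V_def n_def)
  qed
  have miss: "?P {f. \<forall>u\<in>blk j - {v}. \<not> f {v, u}} \<le> exp (- (2 ^ L / 8))" if v: "v \<in> V" and j: "j < d" for v j
  proof -
    have "?P {f. \<forall>u\<in>blk j - {v}. \<not> f {v, u}} \<le> exp (- mean_nbrs lev (lev v) (blk j - {v}))"
      by (rule prob_misses_set[where L = L and T = T]) (use fV lev v blk_V[OF j] in \<open>auto simp: T_def\<close>)
    moreover have "2 ^ L / 8 \<le> mean_nbrs lev (lev v) (blk j - {v})"
    proof -
      have "mean_nbrs lev (lev v) (blk j - {v}) = real (card (blk j - {v})) * (1/2) ^ (lev v + 3)"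
      proof -
        have "lev u = 0" if "u \<in> blk j - {v}" for u
          using blk_less[of u j] j that by (simp add: lev_def)
        then show ?thesis by (simp add: mean_nbrs_def)
      qed
      \<comment> \<open>The vertex \<open>v\<close> may itself lie in the block, which leaves
        \<open>4 ^ L - 1\<close> vertices, at least half of \<open>4 ^ L\<close>.\<close>
      moreover have "(4 ^ L / 2) * (1/2) ^ (L + 2) \<le> real (card (blk j - {v})) * (1/2) ^ (lev v + 3)"
      proof (rule mult_mono)
        have "card (blk j) \<le> card (blk j - {v}) + 1"
          by (simp add: card_Diff_singleton_if) arith
        then have "real (card (blk j)) \<le> real (card (blk j - {v}) + 1)" by (simp only: of_nat_le_iff)
        then have "4 ^ L - 1 \<le> real (card (blk j - {v}))" by (simp add: blk_def)
        moreover have "(2::real) \<le> 4 ^ L" using L self_le_power[of "4::real" L] by simp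
        ultimately show "4 ^ L / 2 \<le> real (card (blk j - {v}))" by simp
        show "(1/2) ^ (L + 2) \<le> (1/2 :: real) ^ (lev v + 3)"
          using lev[OF v] by (intro power_decreasing) auto
      qed auto
      moreover have "(4 ^ L / 2) * (1/2) ^ (L + 2) = (2 ^ L / 8 :: real)"
      proof -
        have "(4::real) ^ L = 2 ^ L * 2 ^ L" by (simp flip: power_mult_distrib)
        then show ?thesis by (simp add: power_add power_divide)
      qed
      ultimately show ?thesis by simp
    qed
    ultimately show ?thesis by (smt (verit) exp_le_cancel_iff)
  qed
  define F2 where "F2 = (\<Union>(v, j)\<in>V \<times> {..<d}. {f. \<forall>u\<in>blk j - {v}. \<not> f {v, u}})"
  have F2: "?P F2 < 1/2"
  proof -
    have "?P F2 \<le> (\<Sum>(v, j)\<in>V \<times> {..<d}. ?P {f. \<forall>u\<in>blk j - {v}. \<not> f {v, u}})"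
      unfolding F2_def case_prod_unfold
      by (rule measure_pmf.finite_measure_subadditive_finite) (use fV in auto)
    also have "\<dots> \<le> (\<Sum>(v, j)\<in>V \<times> {..<d}. exp (- (2 ^ L / 8)))"
      using miss by (intro sum_mono) auto
    also have "\<dots> = real n * real d * exp (- (2 ^ L / 8))"
      by (simp add: case_prod_unfold card_cartesian_product V_def)
    finally show ?thesis using h2 by linarith
  qed
  have "?P (F1 \<union> F2) \<le> ?P F1 + ?P F2"
    by (rule measure_subadditive) (auto simp: measure_pmf.emeasure_finite)
  then have "?P (F1 \<union> F2) < 1" using F1 F2 by linarith
  then obtain f where f: "f \<notin> F1" "f \<notin> F2" using exists_not_in_of_prob_less_1 by blast
  have "d \<le> card {u. u < n \<and> u \<noteq> v \<and> f {v, u}}" if v: "v < n" for v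
  proof -
    have "\<exists>u\<in>blk j - {v}. f {v, u}" if "j < d" for j
      using f(2) v that by (auto simp: F2_def V_def)
    then obtain h where h: "\<And>j. j < d \<Longrightarrow> h j \<in> blk j - {v} \<and> f {v, h j}" by metis
    have "h j div 4 ^ L = j" if "j < d" for j
      using h[OF that] by (intro div_nat_eqI) (auto simp: blk_def mult.commute)
    then have "inj_on h {..<d}" by (metis inj_onI lessThan_iff)
    moreover have "h ` {..<d} \<subseteq> {u. u < n \<and> u \<noteq> v \<and> f {v, u}}"
      using h blk_V by (auto simp: V_def)
    ultimately have "card {..<d} \<le> card {u. u < n \<and> u \<noteq> v \<and> f {v, u}}"
      by (intro card_inj_on_le) auto
    then show ?thesis by simp
  qed
  moreover have "K < card (c ` {..<n})" if "cfcn_coloring (edge_graph {..<n} f) c" for c :: "nat \<Rightarrow> nat"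
    using f(1) that T cfcn_coloring_edge_graph_gt[of V T K f c] fV unfolding F1_def V_def by blast
  ultimately show ?thesis by blast
qed

text \<open>A single test succeeds with probability at least \<open>1 / 2 ^ L\<close>, and
  \<open>5 \<le> r\<close> gives \<open>32 ^ L \<le> M\<close>. So the failure exponent is of order
  \<open>16 ^ L\<close>, which beats the logarithm of the number of families, at most of order
  \<open>L ^ 3 * 4 ^ L\<close>.\<close>

lemma eventually_union_bounds:
  assumes r: "5 \<le> r"
  shows "eventually (\<lambda>L. let M = 2 ^ (r * L); T = 24 * 4 ^ L; K = L\<^sup>2 div 24; n = L * M; d = 2 ^ ((r - 2) * L) in
      real (n + 2) ^ (T * K) * exp (- (exp (- (12 * real K / real L)) * (real M - real T * real K))) < 1/2 \<and>
      real n * real d * exp (- (2 ^ L / 8)) < 1/2) sequentially"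
proof -
  have e2: "(2::real) < exp 1" using exp_lower_Taylor_quadratic[of "1::real"] by simp
  have em1: "exp x < 1/2" if "x < -1" for x :: real
  proof -
    have "exp x \<le> exp (-1)" using that by simp
    also have "exp (-1) = inverse (exp (1::real))" by (rule exp_minus)
    also have "\<dots> < 1/2" using less_imp_inverse_less[OF e2] by simp
    finally show ?thesis .
  qed
  define c where "c = real r"
  have c: "0 < c" using r by (simp add: c_def)
  \<comment> \<open>The first two conditions concern logarithms of the bounds; below
    \<open>-1\<close> suffices because \<open>exp (-1) < 1/2\<close>.\<close>
  have "eventually (\<lambda>L. (c + 2) * real L ^ 3 * 4 ^ L + (real L)\<^sup>2 * 2 ^ L - 16 ^ L < -1) sequentially"
    using c by real_asymp
  moreover have "eventually (\<lambda>L. real L + 2 * c * real L - 2 ^ L / 8 < -1) sequentially"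
    using c by real_asymp
  moreover have "eventually (\<lambda>L. (real L)\<^sup>2 * 4 ^ L \<le> 32 ^ L) sequentially" by real_asymp
  moreover have "eventually (\<lambda>L. 0 < L) sequentially" by (rule eventually_gt_at_top)
  ultimately show ?thesis
  proof eventually_elim
    case (elim L)
    define M T K d where defs: "M = (2::nat) ^ (r * L)" "T = (24::nat) * 4 ^ L" "K = L\<^sup>2 div 24" "d = (2::nat) ^ ((r - 2) * L)"
    define n where "n = L * M"
    have L1: "1 \<le> real L" using elim(4) by simp
    have L2: "L < 2 ^ L" by (rule less_exp)
    have M32: "32 ^ L \<le> real M"
    proof -
      have "(32::real) ^ L = 2 ^ (5 * L)" by (simp add: power_mult)
      also have "\<dots> \<le> 2 ^ (r * L)" using r by (intro power_increasing mult_right_mono) auto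
      finally show ?thesis by (simp add: defs)
    qed
    have K24: "24 * real K \<le> (real L)\<^sup>2"
    proof -
      have "24 * K \<le> L\<^sup>2" by (simp add: defs)
      then have "real (24 * K) \<le> real (L\<^sup>2)" by (simp only: of_nat_le_iff)
      then show ?thesis by simp
    qed
    have TK: "real T * real K \<le> (real L)\<^sup>2 * 4 ^ L"
      using mult_right_mono[OF K24, of "4 ^ L"] by (simp add: defs(2) mult_ac)
    \<comment> \<open>The divisor 24 in \<open>K\<close> is used here: it gives
      \<open>12 * K / L \<le> L / 2 \<le> L * ln 2\<close>.\<close>
    have \<theta>: "1 / 2 ^ L \<le> exp (- (12 * real K / real L))"
    proof -
      have "12 * real K / real L \<le> real L * (1/2)"
        using K24 L1 by (simp add: field_simps power2_eq_square)
      also have "\<dots> \<le> real L * ln 2"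
        using ln2_ge_two_thirds by (intro mult_left_mono) auto
      finally have "exp (- (real L * ln 2)) \<le> exp (- (12 * real K / real L))" by simp
      then show ?thesis by (simp add: exp_minus exp_of_nat_mult inverse_eq_divide)
    qed
    have n2: "real (n + 2) \<le> exp ((c + 2) * real L)"
    proof -
      have "1 \<le> M" by (simp add: defs)
      then have "n + 2 \<le> (L + 2) * M" by (simp add: n_def add_mult_distrib)
      also have "\<dots> \<le> 2 ^ (2 * L) * M"
      proof (rule mult_right_mono)
        have "(2::nat) ^ (2 * L) = 2 ^ L * 2 ^ L" by (simp add: mult_2 power_add)
        moreover have "2 \<le> (2::nat) ^ L" using elim(4) self_le_power[of "2::nat" L] by simp
        moreover have "Suc L \<le> 2 ^ L" using L2 by (rule Suc_leI)
        ultimately show "L + 2 \<le> 2 ^ (2 * L)"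
          using mult_le_mono[of 2 "2 ^ L" "Suc L" "2 ^ L"] by simp
      qed simp
      also have "\<dots> = 2 ^ ((r + 2) * L)" unfolding defs by (simp only: add_mult_distrib add.commute[of "r * L"] power_add)
      finally have "real (n + 2) \<le> real (2 ^ ((r + 2) * L))" by (simp only: of_nat_le_iff)
      also have "\<dots> \<le> exp 1 ^ ((r + 2) * L)" using e2 by (simp add: power_mono)
      also have "\<dots> = exp ((c + 2) * real L)" by (simp add: c_def exp_of_nat_mult[symmetric] algebra_simps)
      finally show ?thesis .
    qed
    have "real (n + 2) ^ (T * K) \<le> exp ((c + 2) * real L) ^ (T * K)"
      using n2 by (intro power_mono) auto
    also have "\<dots> = exp (real T * real K * ((c + 2) * real L))"
      by (simp add: exp_of_nat_mult[symmetric])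
    also have "\<dots> \<le> exp ((real L)\<^sup>2 * 4 ^ L * ((c + 2) * real L))"
      using TK c by (simp add: mult_right_mono)
    finally have A: "real (n + 2) ^ (T * K) \<le> exp ((c + 2) * real L ^ 3 * 4 ^ L)"
      by (simp add: power3_eq_cube power2_eq_square mult_ac)
    have "16 ^ L - (real L)\<^sup>2 * 2 ^ L = (1 / 2 ^ L) * (32 ^ L - (real L)\<^sup>2 * 4 ^ L)"
    proof -
      have "(32::real) ^ L = 2 ^ L * 16 ^ L" "(4::real) ^ L = 2 ^ L * 2 ^ L" by (simp_all flip: power_mult_distrib)
      then show ?thesis by (simp add: field_simps)
    qed
    also have "\<dots> \<le> exp (- (12 * real K / real L)) * (real M - real T * real K)"
    proof (rule mult_mono[OF \<theta>])
      show "32 ^ L - (real L)\<^sup>2 * 4 ^ L \<le> real M - real T * real K" using M32 TK by linarith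
    qed (use elim(3) in auto)
    finally have B: "exp (- (exp (- (12 * real K / real L)) * (real M - real T * real K))) \<le> exp (- (16 ^ L - (real L)\<^sup>2 * 2 ^ L))"
      by simp
    have "real (n + 2) ^ (T * K) * exp (- (exp (- (12 * real K / real L)) * (real M - real T * real K)))
        \<le> exp ((c + 2) * real L ^ 3 * 4 ^ L) * exp (- (16 ^ L - (real L)\<^sup>2 * 2 ^ L))"
      using A B by (intro mult_mono) auto
    also have "\<dots> < 1/2"
      unfolding exp_add[symmetric] by (rule em1) (use elim(1) in linarith)
    finally have h1: "real (n + 2) ^ (T * K) * exp (- (exp (- (12 * real K / real L)) * (real M - real T * real K))) < 1/2" .
    have "real n * real d * exp (- (2 ^ L / 8)) \<le> (exp (real L) * exp (c * real L) * exp (c * real L)) * exp (- (2 ^ L / 8))"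
    proof -
      have "real M \<le> exp 1 ^ (r * L)" using e2 by (simp add: defs power_mono)
      also have "\<dots> = exp (c * real L)" by (simp add: c_def exp_of_nat_mult[symmetric])
      finally have "real M \<le> exp (c * real L)" .
      moreover have "d \<le> M" unfolding defs by (intro power_increasing mult_right_mono) auto
      moreover have "real L \<le> exp (real L)" using exp_ge_add_one_self[of "real L"] by linarith
      ultimately show ?thesis
        unfolding n_def of_nat_mult by (intro mult_right_mono mult_mono) auto
    qed
    also have "\<dots> < 1/2"
      unfolding exp_add[symmetric] by (rule em1) (use elim(2) in linarith)
    finally have h2: "real n * real d * exp (- (2 ^ L / 8)) < 1/2" .
    show ?case
      using h1 h2 by (simp only: Let_def n_def defs)
  qed
qed

theorem theorem6:
  fixes \<epsilon> :: real
  assumes "0 < \<epsilon>" and "\<epsilon> < 0.003"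
  shows "\<exists>c :: real. c > 0 \<and> ( \<forall>N :: nat. \<exists>G :: nat pair_pre_digraph.
           pair_graph G \<and> pverts G \<noteq> {} \<and>
           max_degree G \<ge> N \<and>
           min_degree G = nat \<lceil>real (max_degree G) powr (1 - \<epsilon>)\<rceil> \<and>
           real (chi_CN G) \<ge> c * (ln (real (max_degree G)))\<^sup>2)"
proof -
  \<comment> \<open>\<open>r * \<epsilon> \<ge> 4\<close> yields
    \<open>n powr (- \<epsilon>) \<le> 2 powr (- 4 * L)\<close>. The factor \<open>L\<close> of
    \<open>n\<close> costs at most \<open>2 ^ L\<close>, so \<open>n powr (1 - \<epsilon>)\<close>
    stays below \<open>d\<close>. The summand 5 secures \<open>5 \<le> r\<close>.\<close>
  define r where "r = nat \<lceil>4 / \<epsilon>\<rceil> + 5"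
  have r: "5 \<le> r" by (simp add: r_def)
  have "4 / \<epsilon> \<le> real r" unfolding r_def by linarith
  then have r\<epsilon>: "4 \<le> real r * \<epsilon>" using assms(1) by (simp add: field_simps)
  have "\<exists>G :: nat pair_pre_digraph. pair_graph G \<and> pverts G \<noteq> {} \<and> max_degree G \<ge> N \<and>
      min_degree G = nat \<lceil>real (max_degree G) powr (1 - \<epsilon>)\<rceil> \<and>
      real (chi_CN G) \<ge> 1 / (96 * (real r)\<^sup>2) * (ln (real (max_degree G)))\<^sup>2" for N
  proof -
    obtain L where bounds: "let M = 2 ^ (r * L); T = 24 * 4 ^ L; K = L\<^sup>2 div 24; n = L * M; d = 2 ^ ((r - 2) * L) in
        real (n + 2) ^ (T * K) * exp (- (exp (- (12 * real K / real L)) * (real M - real T * real K))) < 1/2 \<and>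
        real n * real d * exp (- (2 ^ L / 8)) < 1/2"
      and LN: "N < L"
      using eventually_happens[OF eventually_conj[OF eventually_union_bounds[OF r] eventually_gt_at_top[of N]]]
      by auto
    define M K d where defs: "M = (2::nat) ^ (r * L)" "K = L\<^sup>2 div 24" "d = (2::nat) ^ ((r - 2) * L)"
    define n where "n = L * M"
    define m where "m = nat \<lceil>real n powr (1 - \<epsilon>)\<rceil>"
    have L: "0 < L" "1 \<le> real L" using LN by auto
    have M: "0 < M" by (simp add: defs)
    have n: "0 < n" "L \<le> n" using L M by (simp_all add: n_def)
    obtain f where f: "\<And>v. v < n \<Longrightarrow> d \<le> card {u. u < n \<and> u \<noteq> v \<and> f {v, u}}"
        "\<And>c :: nat \<Rightarrow> nat. cfcn_coloring (edge_graph {..<n} f) c \<Longrightarrow> K < card (c ` {..<n})"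
      using exists_edge_set[of L r K] L(1) r bounds unfolding n_def defs Let_def by auto
    have Mpow: "real M = 2 powr (real r * real L)" by (simp add: defs powr_realpow[symmetric])
    have "real n powr (1 - \<epsilon>) = real n * real n powr (- \<epsilon>)"
      using n by (simp add: powr_diff powr_minus divide_inverse)
    also have "\<dots> \<le> (2 powr real L * 2 powr (real r * real L)) * 2 powr (- 4 * real L)"
    proof (rule mult_mono)
      have "real L \<le> 2 powr real L" using less_exp[of L] by (simp add: powr_realpow less_imp_le of_nat_less_two_power)
      then show "real n \<le> 2 powr real L * 2 powr (real r * real L)"
        unfolding n_def of_nat_mult Mpow by (intro mult_right_mono) auto
      have "M \<le> n" using L by (simp add: n_def)
      then have "real M \<le> real n" by (simp only: of_nat_le_iff)
      then have "real n powr (- \<epsilon>) \<le> real M powr (- \<epsilon>)"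
        using M assms(1) by (intro powr_mono2') auto
      also have "\<dots> = 2 powr (- (real r * \<epsilon> * real L))" by (simp add: Mpow powr_powr mult_ac)
      also have "\<dots> \<le> 2 powr (- 4 * real L)"
        using mult_right_mono[OF r\<epsilon>, of "real L"] by (intro powr_mono) auto
      finally show "real n powr (- \<epsilon>) \<le> 2 powr (- 4 * real L)" .
    qed auto
    also have "\<dots> = 2 powr ((real r - 3) * real L)"
      by (simp add: powr_add[symmetric] algebra_simps)
    also have "\<dots> \<le> 2 powr ((real r - 2) * real L)"
      by (intro powr_mono mult_right_mono) auto
    also have "\<dots> = real d" using r by (simp add: defs powr_realpow[symmetric] of_nat_diff)
    finally have "real n powr (1 - \<epsilon>) \<le> real d" .
    then have md: "m \<le> d" by (simp add: m_def ceiling_le_iff nat_le_iff)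
    have "d \<le> M" unfolding defs by (intro power_increasing mult_right_mono) auto
    then have mn: "m \<le> n" using md L by (metis n_def le_trans mult_le_mono1 nat_mult_1 One_nat_def Suc_leI)
    obtain G :: "nat pair_pre_digraph" where G: "pair_graph G" "pverts G \<noteq> {}" "max_degree G = n"
        "min_degree G = m" "Suc K \<le> chi_CN G"
      using exists_graph_with_degrees[of n m f "Suc K"] n mn f md by (meson Suc_leI le_trans)
    have "ln (real n) \<le> 2 * real r * real L"
    proof -
      have "ln (real n) = ln (real L) + real r * real L * ln 2"
        using L M unfolding n_def of_nat_mult by (subst ln_mult) (auto simp: Mpow ln_powr)
      also have "ln (real L) \<le> real L" using ln_le_minus_one[of "real L"] L by linarith
      also have "real r * real L * ln 2 \<le> real r * real L * 1"
        using ln_2_less_1 by (intro mult_left_mono) auto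
      also have "real L + real r * real L * 1 \<le> 2 * real r * real L" using r L by (simp add: mult_right_mono)
      finally show ?thesis by simp
    qed
    then have "(ln (real n))\<^sup>2 \<le> (2 * real r * real L)\<^sup>2" using n by (intro power_mono) auto
    \<comment> \<open>The constant is \<open>96 = 4 * 24\<close>: the 4 comes from squaring
      \<open>ln n \<le> 2 * r * L\<close>, the 24 from \<open>K\<close>.\<close>
    then have "1 / (96 * (real r)\<^sup>2) * (ln (real n))\<^sup>2 \<le> 1 / (96 * (real r)\<^sup>2) * (2 * real r * real L)\<^sup>2"
      by (intro mult_left_mono) auto
    also have "\<dots> = (real L)\<^sup>2 / 24" using r by (simp add: power_mult_distrib)
    also have "\<dots> \<le> real (Suc K)"
    proof -
      have "L\<^sup>2 \<le> 24 * Suc K" unfolding defs by presburger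
      then have "real (L\<^sup>2) \<le> real (24 * Suc K)" by (simp only: of_nat_le_iff)
      then show ?thesis by simp
    qed
    also have "\<dots> \<le> real (chi_CN G)" using G(5) by simp
    finally have "1 / (96 * (real r)\<^sup>2) * (ln (real n))\<^sup>2 \<le> real (chi_CN G)" .
    then show ?thesis using G LN n by (intro exI[of _ G]) (auto simp: m_def)
  qed
  then show ?thesis using r by (intro exI[of _ "1 / (96 * (real r)\<^sup>2)"]) auto
qed

end
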